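(* Let $X$ be a quandle, let $0\to N\xrightarrow{i} G\xrightarrow{p} A\to 0$ be a short exact sequence of $\Lambda$-modules (regarded as Alexander quandles), and let $\eta\in Z^1_{\rm TQ}(X;A)$, i.e. $\eta:X\to A$ is a quandle homomorphism. For a set-theoretic section $s:A\to G$ ($ps=\mathrm{id}_A$) with $s(0)=0$, let $\phi=\phi_s:X\times X\to N$ be the function determined by $$T\,s\eta(x_1)+s\eta(x_2)=i\phi(x_1,x_2)+T\,s\eta(x_2)+s\eta(x_1*x_2)\qquad(x_1,x_2\in X).$$ Then the obstruction to extending $\eta$ to a quandle homomorphism $X\to G$ lies in $H^2_{\rm TQ}(X;N)$, in the following sense: $\phi_s$ is well defined and belongs to $Z^2_{\rm TQ}(X;N)$; its class $[\phi_s]\in H^2_{\rm TQ}(X;N)$ does not depend on the choice of the section $s$ with $s(0)=0$; and if $[\phi_s]=0$, then there is a quandle homomorphism $\eta':X\to G$ with $p\eta'=\eta$.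
   Context: A quandle is a set $X$ with a binary operation $*$ such that (I) $a*a=a$; (II) for all $a,b$ there is a unique $c$ with $a=c*b$; (III) $(a*b)*c=(a*c)*(b*c)$. A quandle homomorphism is a map preserving $*$. Let $\Lambda=\mathbb{Z}[T,T^{-1}]$. An Alexander quandle is a $\Lambda$-module $M$ with operation $a*b=Ta+(1-T)b$. For a quandle $X$, a $\Lambda$-module $A$ and $n\ge 1$, let $C^n_{\rm TQ}(X;A)$ be the $\Lambda$-module of functions $f:X^n\to A$ with $f(x_1,\dots,x_n)=0$ whenever $x_i=x_{i+1}$ for some $i\in\{1,\dots,n-1\}$, and define $\delta:C^n_{\rm TQ}(X;A)\to C^{n+1}_{\rm TQ}(X;A)$ by $$(\delta f)(x_1,\dots,x_{n+1})=(-1)^n\sum_{i=1}^{n+1}(-1)^i\big[T f(x_1,\dots,\widehat{x_i},\dots,x_{n+1})-f(x_1*x_i,\dots,x_{i-1}*x_i,x_{i+1},\dots,x_{n+1})\big].$$ $Z^n_{\rm TQ}(X;A)=\ker\delta$, $B^n_{\rm TQ}(X;A)=\operatorname{im}(\delta:C^{n-1}_{\rm TQ}\to C^n_{\rm TQ})$ (with $B^1_{\rm TQ}=0$), and $H^n_{\rm TQ}(X;A)=Z^n_{\rm TQ}(X;A)/B^n_{\rm TQ}(X;A)$. *)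

theory Defs
  imports Complex_Main "HOL-Library.Poly_Mapping"
begin

section \<open>Quandles\<close>

locale quandle =
  fixes X :: "'x set" and op :: "'x \<Rightarrow> 'x \<Rightarrow> 'x"
  assumes closed: "\<lbrakk>a \<in> X; b \<in> X\<rbrakk> \<Longrightarrow> op a b \<in> X"
    and idem: "a \<in> X \<Longrightarrow> op a a = a"
    and right_div: "\<lbrakk>a \<in> X; b \<in> X\<rbrakk> \<Longrightarrow> \<exists>!c. c \<in> X \<and> a = op c b"
    and self_distrib: "\<lbrakk>a \<in> X; b \<in> X; c \<in> X\<rbrakk> \<Longrightarrow> op (op a b) c = op (op a c) (op b c)"

definition quandle_hom ::
  "'x set \<Rightarrow> ('x \<Rightarrow> 'x \<Rightarrow> 'x) \<Rightarrow> 'y set \<Rightarrow> ('y \<Rightarrow> 'y \<Rightarrow> 'y) \<Rightarrow> ('x \<Rightarrow> 'y) \<Rightarrow> bool" where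
  "quandle_hom X op Y op' f \<longleftrightarrow>
     (\<forall>x\<in>X. f x \<in> Y) \<and> (\<forall>x\<in>X. \<forall>y\<in>X. f (op x y) = op' (f x) (f y))"


section \<open>Modules over the Laurent polynomial ring\<close>

text \<open>The ring \<open>\<int>[T, T\<^sup>-\<^sup>1]\<close> is the ring of finitely supported functions on
  the exponents \<open>int\<close> with convolution product. A module over it is given by a type of class
  \<open>ab_group_add\<close> and a scalar multiplication satisfying the library locale \<open>module\<close>.\<close>

type_synonym laurent = "int \<Rightarrow>\<^sub>0 int"

definition T :: laurent where
  "T = Poly_Mapping.single 1 1"

definition alexander :: "(laurent \<Rightarrow> 'a \<Rightarrow> 'a) \<Rightarrow> 'a \<Rightarrow> 'a \<Rightarrow> 'a::ab_group_add" where
  "alexander scale a b = scale T a + scale (1 - T) b"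

locale short_exact_sequence =
  i: module_hom scaleN scaleG i + p: module_hom scaleG scaleA p
  for scaleN :: "laurent \<Rightarrow> 'n \<Rightarrow> 'n::ab_group_add"
    and scaleG :: "laurent \<Rightarrow> 'g \<Rightarrow> 'g::ab_group_add"
    and scaleA :: "laurent \<Rightarrow> 'a \<Rightarrow> 'a::ab_group_add"
    and i :: "'n \<Rightarrow> 'g" and p :: "'g \<Rightarrow> 'a" +
  assumes inj_i: "inj i"
    and exact: "range i = {g. p g = 0}"
    and surj_p: "surj p"


section \<open>Twisted quandle cohomology\<close>

text \<open>Functions \<open>X\<^sup>n \<rightarrow> A\<close> are functions on lists, restricted to lists of length \<open>n\<close> with entries
  in \<open>X\<close>; to make equality of functions meaningful, the value elsewhere is fixed to be \<open>0\<close>.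
  The entry \<open>x\<^sub>i\<close> of a tuple is \<open>xs ! (i - 1)\<close>.\<close>

definition tuples :: "'x set \<Rightarrow> nat \<Rightarrow> 'x list set" where
  "tuples X n = {xs. length xs = n \<and> set xs \<subseteq> X}"

definition funs :: "'x set \<Rightarrow> nat \<Rightarrow> ('x list \<Rightarrow> 'a::zero) set" where
  "funs X n = {f. \<forall>xs. xs \<notin> tuples X n \<longrightarrow> f xs = 0}"

definition CTQ :: "'x set \<Rightarrow> nat \<Rightarrow> ('x list \<Rightarrow> 'a::zero) set" where
  "CTQ X n = {f \<in> funs X n. \<forall>xs \<in> tuples X n.
     (\<exists>i\<in>{1..<n}. xs ! (i - 1) = xs ! i) \<longrightarrow> f xs = 0}"

definition delta ::
  "'x set \<Rightarrow> ('x \<Rightarrow> 'x \<Rightarrow> 'x) \<Rightarrow> (laurent \<Rightarrow> 'a \<Rightarrow> 'a) \<Rightarrow> nat \<Rightarrow>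
   ('x list \<Rightarrow> 'a) \<Rightarrow> 'x list \<Rightarrow> 'a::ab_group_add" where
  "delta X op scale n f xs =
     (if xs \<in> tuples X (n + 1) then
        scale ((- 1) ^ n) (\<Sum>i = 1..n + 1. scale ((- 1) ^ i)
          (scale T (f (take (i - 1) xs @ drop i xs))
           - f (map (\<lambda>x. op x (xs ! (i - 1))) (take (i - 1) xs) @ drop i xs)))
      else 0)"

definition ZTQ ::
  "'x set \<Rightarrow> ('x \<Rightarrow> 'x \<Rightarrow> 'x) \<Rightarrow> (laurent \<Rightarrow> 'a \<Rightarrow> 'a) \<Rightarrow> nat \<Rightarrow> ('x list \<Rightarrow> 'a::ab_group_add) set"
  where
  "ZTQ X op scale n = {f \<in> CTQ X n. delta X op scale n f = (\<lambda>_. 0)}"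

definition BTQ ::
  "'x set \<Rightarrow> ('x \<Rightarrow> 'x \<Rightarrow> 'x) \<Rightarrow> (laurent \<Rightarrow> 'a \<Rightarrow> 'a) \<Rightarrow> nat \<Rightarrow> ('x list \<Rightarrow> 'a::ab_group_add) set"
  where
  "BTQ X op scale n =
     (if n \<le> 1 then {\<lambda>_. 0} else delta X op scale (n - 1) ` CTQ X (n - 1))"

definition cohomologous ::
  "'x set \<Rightarrow> ('x \<Rightarrow> 'x \<Rightarrow> 'x) \<Rightarrow> (laurent \<Rightarrow> 'a \<Rightarrow> 'a) \<Rightarrow> nat \<Rightarrow>
   (('x list \<Rightarrow> 'a::ab_group_add) \<times> ('x list \<Rightarrow> 'a)) set" where
  "cohomologous X op scale n =
     {(f, g). f \<in> ZTQ X op scale n \<and> g \<in> ZTQ X op scale n \<and>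
        (\<lambda>xs. f xs - g xs) \<in> BTQ X op scale n}"

definition HTQ ::
  "'x set \<Rightarrow> ('x \<Rightarrow> 'x \<Rightarrow> 'x) \<Rightarrow> (laurent \<Rightarrow> 'a \<Rightarrow> 'a) \<Rightarrow> nat \<Rightarrow>
   ('x list \<Rightarrow> 'a::ab_group_add) set set" where
  "HTQ X op scale n = ZTQ X op scale n // cohomologous X op scale n"

definition HTQ_class ::
  "'x set \<Rightarrow> ('x \<Rightarrow> 'x \<Rightarrow> 'x) \<Rightarrow> (laurent \<Rightarrow> 'a \<Rightarrow> 'a) \<Rightarrow> nat \<Rightarrow>
   ('x list \<Rightarrow> 'a::ab_group_add) \<Rightarrow> ('x list \<Rightarrow> 'a) set" where
  "HTQ_class X op scale n f = cohomologous X op scale n `` {f}"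

definition HTQ_zero ::
  "'x set \<Rightarrow> ('x \<Rightarrow> 'x \<Rightarrow> 'x) \<Rightarrow> (laurent \<Rightarrow> 'a \<Rightarrow> 'a) \<Rightarrow> nat \<Rightarrow>
   ('x list \<Rightarrow> 'a::ab_group_add) set" where
  "HTQ_zero X op scale n = HTQ_class X op scale n (\<lambda>_. 0)"

text \<open>The 1-cochain given by a map defined on \<open>X\<close>.\<close>

definition cochain1 :: "'x set \<Rightarrow> ('x \<Rightarrow> 'a) \<Rightarrow> 'x list \<Rightarrow> 'a::zero" where
  "cochain1 X h xs = (if xs \<in> tuples X 1 then h (xs ! 0) else 0)"


section \<open>The obstruction cochain\<close>

definition pointed_section :: "('g::zero \<Rightarrow> 'a::zero) \<Rightarrow> ('a \<Rightarrow> 'g) \<Rightarrow> bool" where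
  "pointed_section p s \<longleftrightarrow> (\<forall>a. p (s a) = a) \<and> s 0 = 0"

definition is_obstruction ::
  "'x set \<Rightarrow> ('x \<Rightarrow> 'x \<Rightarrow> 'x) \<Rightarrow> (laurent \<Rightarrow> 'g \<Rightarrow> 'g::ab_group_add) \<Rightarrow> ('n::zero \<Rightarrow> 'g) \<Rightarrow>
   ('x \<Rightarrow> 'a) \<Rightarrow> ('a \<Rightarrow> 'g) \<Rightarrow> ('x list \<Rightarrow> 'n) \<Rightarrow> bool" where
  "is_obstruction X op scaleG i \<eta> s \<phi> \<longleftrightarrow> \<phi> \<in> funs X 2 \<and>
     (\<forall>x1\<in>X. \<forall>x2\<in>X.
        scaleG T (s (\<eta> x1)) + s (\<eta> x2) =
        i (\<phi> [x1, x2]) + scaleG T (s (\<eta> x2)) + s (\<eta> (op x1 x2)))"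

definition obstruction ::
  "'x set \<Rightarrow> ('x \<Rightarrow> 'x \<Rightarrow> 'x) \<Rightarrow> (laurent \<Rightarrow> 'g \<Rightarrow> 'g::ab_group_add) \<Rightarrow> ('n::zero \<Rightarrow> 'g) \<Rightarrow>
   ('x \<Rightarrow> 'a) \<Rightarrow> ('a \<Rightarrow> 'g) \<Rightarrow> 'x list \<Rightarrow> 'n" where
  "obstruction X op scaleG i \<eta> s = (THE \<phi>. is_obstruction X op scaleG i \<eta> s \<phi>)"


section \<open>Basic facts\<close>

lemma T_inverse: "T * Poly_Mapping.single (- 1) 1 = 1" "Poly_Mapping.single (- 1) 1 * T = 1"
  by (simp_all add: T_def mult_single)

lemma quandle_alexander:
  assumes "module scale"
  shows "quandle UNIV (alexander scale)"
proof -
  interpret module scale by fact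
  define U :: laurent where "U = Poly_Mapping.single (- 1) 1"
  have U: "T * U = 1" "U * T = 1"
    by (simp_all add: U_def T_inverse)
  show ?thesis
  proof
    fix a b c
    show "alexander scale a a = a"
      by (simp add: alexander_def scale_left_diff_distrib)
    show "\<exists>!c. c \<in> UNIV \<and> a = alexander scale c b"
    proof (rule ex1I)
      show "scale U (a - scale (1 - T) b) \<in> UNIV \<and>
        a = alexander scale (scale U (a - scale (1 - T) b)) b"
        by (simp add: alexander_def U)
    next
      fix d assume "d \<in> UNIV \<and> a = alexander scale d b"
      then show "d = scale U (a - scale (1 - T) b)"
        by (simp add: alexander_def U)
    qed
    show "alexander scale (alexander scale a b) c =
      alexander scale (alexander scale a c) (alexander scale b c)"
      by (simp add: alexander_def algebra_simps)
  qed simp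
qed

lemma ZTQ_1_iff_quandle_hom:
  assumes "module scale" and "quandle X op"
  shows "cochain1 X h \<in> ZTQ X op scale 1 \<longleftrightarrow> quandle_hom X op UNIV (alexander scale) h"
proof -
  interpret module scale by fact
  interpret quandle X op by fact
  have C: "cochain1 X h \<in> CTQ X 1"
    by (auto simp: CTQ_def funs_def cochain1_def)
  have two: "{1..1 + 1 :: nat} = {1, 2}" by auto
  have D: "delta X op scale 1 (cochain1 X h) [x, y] =
      h (op x y) - alexander scale (h x) (h y)" if "x \<in> X" "y \<in> X" for x y
    using that closed[OF that]
    by (simp add: delta_def two tuples_def cochain1_def alexander_def algebra_simps)
  have E: "delta X op scale 1 (cochain1 X h) xs = 0" if "\<nexists>x y. x \<in> X \<and> y \<in> X \<and> xs = [x, y]" for xs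
  proof -
    have "xs \<notin> tuples X (1 + 1)"
      using that by (auto simp: tuples_def length_Suc_conv) blast
    then show ?thesis by (simp add: delta_def)
  qed
  show ?thesis
  proof
    assume "cochain1 X h \<in> ZTQ X op scale 1"
    then show "quandle_hom X op UNIV (alexander scale) h"
      using D by (auto simp: ZTQ_def quandle_hom_def fun_eq_iff)
  next
    assume H: "quandle_hom X op UNIV (alexander scale) h"
    have "delta X op scale 1 (cochain1 X h) xs = 0" for xs
    proof (cases "\<exists>x y. x \<in> X \<and> y \<in> X \<and> xs = [x, y]")
      case True
      then show ?thesis using H D by (auto simp: quandle_hom_def)
    qed (use E in blast)
    then show "cochain1 X h \<in> ZTQ X op scale 1"
      using C by (simp add: ZTQ_def fun_eq_iff)
  qed
qed

lemma delta_diff: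
  assumes "module scale"
  shows "delta X op scale n (\<lambda>xs. f xs - g xs) xs =
    delta X op scale n f xs - delta X op scale n g xs"
proof -
  interpret module scale by fact
  show ?thesis
    by (simp add: delta_def scale_right_diff_distrib sum_subtractf del: sum.cl_ivl_Suc)
qed

lemma equiv_cohomologous:
  assumes "module scale"
  shows "equiv (ZTQ X op scale n) (cohomologous X op scale n)"
proof -
  interpret module scale by fact
  let ?B = "BTQ X op scale n"
  have zero: "(\<lambda>_. 0) \<in> ?B"
    by (auto simp: BTQ_def CTQ_def funs_def delta_def fun_eq_iff intro!: image_eqI[of _ _ "\<lambda>_. 0"])
  have diff: "(\<lambda>xs. f xs - g xs) \<in> ?B" if "f \<in> ?B" "g \<in> ?B" for f g
  proof (cases "n \<le> 1")
    case True
    then show ?thesis using that by (simp add: BTQ_def)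
  next
    case False
    then obtain u v where "f = delta X op scale (n - 1) u" "g = delta X op scale (n - 1) v"
      and uv: "u \<in> CTQ X (n - 1)" "v \<in> CTQ X (n - 1)"
      using \<open>f \<in> ?B\<close> \<open>g \<in> ?B\<close> by (auto simp: BTQ_def)
    then have "(\<lambda>xs. f xs - g xs) = delta X op scale (n - 1) (\<lambda>xs. u xs - v xs)"
      by (simp add: delta_diff[OF assms] fun_eq_iff)
    moreover have "(\<lambda>xs. u xs - v xs) \<in> CTQ X (n - 1)"
      using uv by (auto simp: CTQ_def funs_def)
    ultimately show ?thesis using False by (auto simp: BTQ_def)
  qed
  have neg: "(\<lambda>xs. g xs - f xs) \<in> ?B" if "(\<lambda>xs. f xs - g xs) \<in> ?B" for f g
    using diff[OF zero that] by simp
  have trans: "(\<lambda>xs. f xs - h xs) \<in> ?B"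
    if "(\<lambda>xs. f xs - g xs) \<in> ?B" "(\<lambda>xs. g xs - h xs) \<in> ?B" for f g h
    using diff[OF that(1) neg[OF that(2)]] by simp
  show ?thesis
    by (rule equivI)
      (auto simp: cohomologous_def refl_on_def sym_def trans_def zero intro: neg trans)
qed

end

theory Submission
  imports Defs
begin

text \<open>Write \<open>h = s \<circ> \<eta>\<close> for the lift of \<open>\<eta>\<close> chosen by the section. The equation that determines
  \<open>\<phi>\<close> says exactly that \<open>i \<circ> \<phi> = \<delta>(- h)\<close> as cochains with values in the middle module
  (\<open>is_obstruction_iff_coboundary\<close>): up to sign, its class is the
  image of \<open>\<eta>\<close> under the connecting homomorphism. Everything follows from three facts: \<open>\<delta>\<close> commutes with module
  homomorphisms (\<open>delta_hom\<close>), \<open>\<delta>\<close> maps 1-cochains to cochains vanishing on degenerate pairs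
  (\<open>delta_1_in_CTQ\<close>), and \<open>\<delta>\<delta> = 0\<close> on 1-cochains (\<open>delta_2_delta_1\<close>).

  Since \<open>p \<circ> \<delta>(- h) = \<delta>(- \<eta>) = 0\<close>, exactness yields \<open>\<phi>\<close>, and injectivity of \<open>i\<close> makes it unique
  and transfers the cocycle condition from \<open>\<delta>\<delta>(- h) = 0\<close>. Two sections give lifts differing by
  \<open>i \<circ> \<nu>\<close>, so the obstructions differ by the coboundary of \<open>\<nu>\<close>. Finally, if \<open>\<phi> = \<delta>\<psi>\<close>, then
  \<open>\<delta>(h + i \<circ> \<psi>) = 0\<close>, which makes \<open>h + i \<circ> \<psi>\<close> a quandle homomorphism lifting \<open>\<eta>\<close>.\<close>

section \<open>The coboundary in low degrees\<close>

lemma tuples_1_iff: "xs \<in> tuples X 1 \<longleftrightarrow> (\<exists>x\<in>X. xs = [x])"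
  by (auto simp: tuples_def length_Suc_conv)

lemma tuples_2_iff: "xs \<in> tuples X 2 \<longleftrightarrow> (\<exists>x\<in>X. \<exists>y\<in>X. xs = [x, y])"
  by (auto simp: tuples_def length_Suc_conv numeral_2_eq_2)

lemma tuples_3_iff: "xs \<in> tuples X 3 \<longleftrightarrow> (\<exists>x\<in>X. \<exists>y\<in>X. \<exists>z\<in>X. xs = [x, y, z])"
  by (auto simp: tuples_def length_Suc_conv numeral_3_eq_3)

lemma cochain1_in_CTQ: "cochain1 X h \<in> CTQ X 1"
  by (auto simp: CTQ_def funs_def cochain1_def)

lemma cochain1_diff:
  fixes f g :: "'x \<Rightarrow> 'a::ab_group_add"
  shows "cochain1 X (\<lambda>x. f x - g x) = (\<lambda>xs. cochain1 X f xs - cochain1 X g xs)"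
  by (auto simp: cochain1_def)

lemma delta_1_eq_0: "xs \<notin> tuples X 2 \<Longrightarrow> delta X op scale 1 f xs = 0"
  by (simp add: delta_def numeral_2_eq_2)

lemma delta_2_eq_0: "xs \<notin> tuples X 3 \<Longrightarrow> delta X op scale 2 f xs = 0"
  by (simp add: delta_def)

lemma delta_1_cochain1:
  assumes "module scale" and "quandle X op" and "x \<in> X" and "y \<in> X"
  shows "delta X op scale 1 (cochain1 X h) [x, y] = h (op x y) - alexander scale (h x) (h y)"
proof -
  interpret module scale by fact
  interpret quandle X op by fact
  have "{1..1 + 1 :: nat} = {1, 2}" by auto
  then show ?thesis
    using assms(3,4) closed[OF assms(3,4)]
    by (simp add: delta_def tuples_def cochain1_def alexander_def algebra_simps)
qed

lemma delta_2:
  assumes "module scale" and "x \<in> X" and "y \<in> X" and "z \<in> X"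
  shows "delta X op scale 2 f [x, y, z] =
    - (scale T (f [y, z]) - f [y, z]) + (scale T (f [x, z]) - f [op x y, z])
    - (scale T (f [x, y]) - f [op x z, op y z])"
proof -
  interpret module scale by fact
  have "{1..2 + 1 :: nat} = {1, 2, 3}" by auto
  then show ?thesis
    using assms(2-4) by (simp add: delta_def tuples_def)
qed

lemma BTQ_2: "BTQ X op scale 2 = delta X op scale 1 ` CTQ X 1"
  by (simp add: BTQ_def)

(* The default rule turns the degree 1 into Suc 0, after which the lemmas on 1-cochains no longer
   match. *)
declare One_nat_def [simp del]

lemma CTQ_1_eq_cochain1:
  assumes "f \<in> CTQ X 1"
  shows "f = cochain1 X (\<lambda>x. f [x])"
proof
  fix xs
  show "f xs = cochain1 X (\<lambda>x. f [x]) xs"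
    using assms by (cases "xs \<in> tuples X 1") (auto simp: CTQ_def funs_def cochain1_def tuples_1_iff)
qed

text \<open>The value on \<open>(x, x)\<close> vanishes because both quandle operations are idempotent.\<close>

lemma delta_1_in_CTQ:
  assumes "module scale" and "quandle X op" and "f \<in> CTQ X 1"
  shows "delta X op scale 1 f \<in> CTQ X 2"
proof -
  interpret module scale by fact
  interpret quandle X op by fact
  have "alexander scale a a = a" for a
    by (simp add: alexander_def scale_left_diff_distrib)
  then have "delta X op scale 1 (cochain1 X (\<lambda>x. f [x])) [x, x] = 0" if "x \<in> X" for x
    using that by (simp only: delta_1_cochain1[OF assms(1,2)] idem) simp
  then have diag: "delta X op scale 1 f [x, x] = 0" if "x \<in> X" for x
    using that by (subst CTQ_1_eq_cochain1[OF assms(3)])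
  have "delta X op scale 1 f xs = 0"
    if "xs \<in> tuples X 2" and "\<exists>i\<in>{1..<2}. xs ! (i - 1) = xs ! i" for xs
  proof -
    have "{1..<2 :: nat} = {1}" by auto
    with that have "\<exists>x\<in>X. xs = [x, x]"
      by (auto simp: tuples_2_iff)
    then show ?thesis using diag by blast
  qed
  then show ?thesis
    by (simp add: CTQ_def funs_def delta_1_eq_0)
qed

lemma delta_2_delta_1:
  assumes "module scale" and "quandle X op" and "f \<in> CTQ X 1"
  shows "delta X op scale 2 (delta X op scale 1 f) = (\<lambda>_. 0)"
proof
  fix xs
  interpret module scale by fact
  interpret quandle X op by fact
  define h where "h = (\<lambda>x. f [x])"
  have f: "f = cochain1 X h"
    unfolding h_def by (rule CTQ_1_eq_cochain1[OF assms(3)])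
  show "delta X op scale 2 (delta X op scale 1 f) xs = 0"
  proof (cases "xs \<in> tuples X 3")
    case True
    then obtain x y z where xyz: "x \<in> X" "y \<in> X" "z \<in> X" "xs = [x, y, z]"
      by (auto simp: tuples_3_iff)
    \<comment> \<open>Self-distributivity cancels the values of \<open>h\<close> at the two triple products; all other terms
      cancel by linearity.\<close>
    have "op (op x y) z = op (op x z) (op y z)"
      using self_distrib xyz by blast
    then show ?thesis
      using xyz closed
      by (simp add: f delta_2[OF assms(1)] delta_1_cochain1[OF assms(1,2)]
          alexander_def algebra_simps)
  qed (simp add: delta_2_eq_0)
qed

lemma ZTQ_1_of_delta_eq_0:
  "delta X op scale 1 (cochain1 X h) = (\<lambda>_. 0) \<Longrightarrow> cochain1 X h \<in> ZTQ X op scale 1"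
  using cochain1_in_CTQ[of X h] by (simp add: ZTQ_def)


section \<open>Change of coefficients\<close>

lemma delta_hom:
  assumes "module_hom scale scale' k"
  shows "delta X op scale' n (\<lambda>xs. k (f xs)) = (\<lambda>xs. k (delta X op scale n f xs))"
proof
  fix xs
  interpret module_hom scale scale' k by fact
  show "delta X op scale' n (\<lambda>xs. k (f xs)) xs = k (delta X op scale n f xs)"
    by (simp add: delta_def scale sum diff zero del: sum.cl_ivl_Suc)
qed

lemma cochain1_hom:
  assumes "module_hom scale scale' k"
  shows "cochain1 X (\<lambda>x. k (h x)) = (\<lambda>xs. k (cochain1 X h xs))"
proof -
  interpret module_hom scale scale' k by fact
  show ?thesis by (auto simp: cochain1_def zero)
qed

text \<open>The image of \<open>\<phi>\<close> under \<open>k\<close> is a coboundary, hence a cocycle, and an injective \<open>k\<close> reflects both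
  the vanishing on degenerate pairs and the vanishing of \<open>\<delta>\<phi>\<close>.\<close>

lemma ZTQ_2_of_hom_image_coboundary:
  assumes hom: "module_hom scale scale' k" and "inj k" and "quandle X op"
    and f: "f \<in> CTQ X 1" and eq: "(\<lambda>xs. k (\<phi> xs)) = delta X op scale' 1 f"
  shows "\<phi> \<in> ZTQ X op scale 2"
proof -
  interpret module_hom scale scale' k by fact
  have k0: "k a = 0 \<longleftrightarrow> a = 0" for a
    using \<open>inj k\<close> zero by (metis injD)
  have mod: "module scale'" by (rule m2.module_axioms)
  have "(\<lambda>xs. k (\<phi> xs)) \<in> CTQ X 2"
    unfolding eq by (rule delta_1_in_CTQ[OF mod assms(3) f])
  then have "\<phi> \<in> CTQ X 2"
    by (simp add: CTQ_def funs_def k0)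
  moreover have "(\<lambda>xs. k (delta X op scale 2 \<phi> xs)) = (\<lambda>_. 0)"
    using delta_2_delta_1[OF mod assms(3) f] unfolding eq[symmetric] delta_hom[OF hom] .
  then have "delta X op scale 2 \<phi> = (\<lambda>_. 0)"
    by (simp add: fun_eq_iff k0)
  ultimately show ?thesis by (simp add: ZTQ_def)
qed


section \<open>The obstruction cocycle\<close>

text \<open>In \<open>\<delta>(- h)\<close> the sign is forced by the convention that \<open>i \<circ> \<phi>\<close> measures the product of the lifts
  minus the lift of the product. Injectivity of \<open>i\<close> ensures that \<open>\<phi>\<close> vanishes off \<open>X \<times> X\<close>, as the
  coboundary does.\<close>

lemma is_obstruction_iff_coboundary:
  assumes hom: "module_hom scaleN scaleG i" and "inj i" and "quandle X op"
  shows "is_obstruction X op scaleG i \<eta> s \<phi> \<longleftrightarrow>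
    (\<lambda>xs. i (\<phi> xs)) = delta X op scaleG 1 (cochain1 X (\<lambda>x. - s (\<eta> x)))"
    (is "_ \<longleftrightarrow> _ = ?d")
proof -
  interpret module_hom scaleN scaleG i by fact
  have i0: "i a = 0 \<longleftrightarrow> a = 0" for a
    using \<open>inj i\<close> zero by (metis injD)
  have out: "?d xs = 0" if "xs \<notin> tuples X 2" for xs
    using that by (rule delta_1_eq_0)
  have d: "?d [x, y] = scaleG T (s (\<eta> x)) + s (\<eta> y) - scaleG T (s (\<eta> y)) - s (\<eta> (op x y))"
    if "x \<in> X" "y \<in> X" for x y
    by (subst delta_1_cochain1[OF m2.module_axioms \<open>quandle X op\<close> that])
      (simp add: alexander_def m2.scale_left_diff_distrib)
  have "is_obstruction X op scaleG i \<eta> s \<phi> \<longleftrightarrow>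
      \<phi> \<in> funs X 2 \<and> (\<forall>x\<in>X. \<forall>y\<in>X. i (\<phi> [x, y]) = ?d [x, y])"
    unfolding is_obstruction_def
    by (intro conj_cong ball_cong refl) (auto simp only: d algebra_simps)
  also have "\<dots> \<longleftrightarrow> (\<forall>xs. i (\<phi> xs) = ?d xs)"
  proof
    assume L: "\<phi> \<in> funs X 2 \<and> (\<forall>x\<in>X. \<forall>y\<in>X. i (\<phi> [x, y]) = ?d [x, y])"
    show "\<forall>xs. i (\<phi> xs) = ?d xs"
    proof
      fix xs
      show "i (\<phi> xs) = ?d xs"
      proof (cases "xs \<in> tuples X 2")
        case True
        then show ?thesis using L unfolding tuples_2_iff by blast
      next
        case False
        then show ?thesis using L out by (simp add: funs_def i0)
      qed
    qed
  next
    assume R: "\<forall>xs. i (\<phi> xs) = ?d xs"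
    have "\<phi> xs = 0" if "xs \<notin> tuples X 2" for xs
      using R out[OF that] i0 by metis
    with R show "\<phi> \<in> funs X 2 \<and> (\<forall>x\<in>X. \<forall>y\<in>X. i (\<phi> [x, y]) = ?d [x, y])"
      by (auto simp only: funs_def mem_Collect_eq)
  qed
  finally show ?thesis by (simp only: fun_eq_iff)
qed

lemma ex1_is_obstruction:
  assumes X: "quandle X op" and "short_exact_sequence scaleN scaleG scaleA i p"
    and \<eta>: "cochain1 X \<eta> \<in> ZTQ X op scaleA 1" and s: "pointed_section p s"
  shows "\<exists>!\<phi>. is_obstruction X op scaleG i \<eta> s \<phi>"
proof -
  interpret short_exact_sequence scaleN scaleG scaleA i p by fact
  note iff = is_obstruction_iff_coboundary[OF i.module_hom_axioms inj_i X]
  let ?h = "\<lambda>x. - s (\<eta> x)"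
  \<comment> \<open>The difference with \<open>0\<close> lets additivity of \<open>\<delta>\<close> be used in the form \<open>delta_diff\<close>.\<close>
  have ph: "(\<lambda>x. p (?h x)) = (\<lambda>x. 0 - \<eta> x)"
    using s by (simp add: pointed_section_def p.neg)
  have "(\<lambda>xs. p (delta X op scaleG 1 (cochain1 X ?h) xs)) =
      delta X op scaleA 1 (cochain1 X (\<lambda>x. 0 - \<eta> x))"
    unfolding ph[symmetric] delta_hom[OF p.module_hom_axioms, symmetric]
      cochain1_hom[OF p.module_hom_axioms] ..
  also have "\<dots> = (\<lambda>xs. delta X op scaleA 1 (cochain1 X (\<lambda>_. 0)) xs
      - delta X op scaleA 1 (cochain1 X \<eta>) xs)"
    by (rule ext) (simp only: cochain1_diff delta_diff[OF p.m2.module_axioms])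
  also have "\<dots> = (\<lambda>_. 0)"
    using \<eta> by (simp add: ZTQ_def delta_def cochain1_def fun_eq_iff)
  finally have "delta X op scaleG 1 (cochain1 X ?h) xs \<in> range i" for xs
    by (simp only: exact mem_Collect_eq fun_eq_iff)
  then have "(\<lambda>xs. i (inv i (delta X op scaleG 1 (cochain1 X ?h) xs))) =
      delta X op scaleG 1 (cochain1 X ?h)"
    by (simp only: f_inv_into_f)
  then have "is_obstruction X op scaleG i \<eta> s (\<lambda>xs. inv i (delta X op scaleG 1 (cochain1 X ?h) xs))"
    by (simp only: iff)
  moreover have "\<phi> = \<psi>"
    if "is_obstruction X op scaleG i \<eta> s \<phi>" "is_obstruction X op scaleG i \<eta> s \<psi>" for \<phi> \<psi>
  proof
    fix xs
    have "i (\<phi> xs) = i (\<psi> xs)"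
      using that unfolding iff by metis
    then show "\<phi> xs = \<psi> xs" by (rule injD[OF inj_i])
  qed
  ultimately show ?thesis by blast
qed

lemma image_obstruction:
  assumes "quandle X op" and "short_exact_sequence scaleN scaleG scaleA i p"
    and "cochain1 X \<eta> \<in> ZTQ X op scaleA 1" and "pointed_section p s"
  shows "(\<lambda>xs. i (obstruction X op scaleG i \<eta> s xs)) =
    delta X op scaleG 1 (cochain1 X (\<lambda>x. - s (\<eta> x)))"
proof -
  interpret short_exact_sequence scaleN scaleG scaleA i p by fact
  have "is_obstruction X op scaleG i \<eta> s (obstruction X op scaleG i \<eta> s)"
    unfolding obstruction_def by (rule theI'[OF ex1_is_obstruction[OF assms]])
  then show ?thesis
    by (simp only: is_obstruction_iff_coboundary[OF i.module_hom_axioms inj_i assms(1)])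
qed

lemma obstruction_in_ZTQ:
  assumes "quandle X op" and "short_exact_sequence scaleN scaleG scaleA i p"
    and "cochain1 X \<eta> \<in> ZTQ X op scaleA 1" and "pointed_section p s"
  shows "obstruction X op scaleG i \<eta> s \<in> ZTQ X op scaleN 2"
proof -
  interpret short_exact_sequence scaleN scaleG scaleA i p by fact
  show ?thesis
    by (rule ZTQ_2_of_hom_image_coboundary[OF i.module_hom_axioms inj_i assms(1) cochain1_in_CTQ
          image_obstruction[OF assms]])
qed

lemma obstruction_diff_in_BTQ:
  assumes "quandle X op" and "short_exact_sequence scaleN scaleG scaleA i p"
    and "cochain1 X \<eta> \<in> ZTQ X op scaleA 1" and s: "pointed_section p s" and s': "pointed_section p s'"
  shows "(\<lambda>xs. obstruction X op scaleG i \<eta> s xs - obstruction X op scaleG i \<eta> s' xs)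
    \<in> BTQ X op scaleN 2"
proof -
  interpret short_exact_sequence scaleN scaleG scaleA i p by fact
  let ?\<phi> = "obstruction X op scaleG i \<eta> s" and ?\<phi>' = "obstruction X op scaleG i \<eta> s'"
  have "s' a - s a \<in> range i" for a
    using s s' by (simp add: exact p.diff pointed_section_def)
  \<comment> \<open>The order of the difference matches the lifts \<open>- s \<circ> \<eta>\<close> and \<open>- s' \<circ> \<eta>\<close> in \<open>image_obstruction\<close>.\<close>
  then have "\<exists>\<nu>. \<forall>x. i (\<nu> x) = s' (\<eta> x) - s (\<eta> x)"
    by (intro choice allI) (metis rangeE)
  then obtain \<nu> where \<nu>: "(\<lambda>x. i (\<nu> x)) = (\<lambda>x. - s (\<eta> x) - - s' (\<eta> x))"
    by auto
  have "(\<lambda>xs. i (?\<phi> xs - ?\<phi>' xs)) = (\<lambda>xs. i (?\<phi> xs) - i (?\<phi>' xs))"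
    by (simp add: i.diff)
  also have "\<dots> = delta X op scaleG 1 (cochain1 X (\<lambda>x. - s (\<eta> x) - - s' (\<eta> x)))"
    by (rule ext) (simp only: fun_cong[OF image_obstruction[OF assms(1-3) s]]
        fun_cong[OF image_obstruction[OF assms(1-3) s']] cochain1_diff
        delta_diff[OF i.m2.module_axioms])
  also have "\<dots> = (\<lambda>xs. i (delta X op scaleN 1 (cochain1 X \<nu>) xs))"
    by (simp only: \<nu>[symmetric] cochain1_hom[OF i.module_hom_axioms]
        delta_hom[OF i.module_hom_axioms])
  finally have "(\<lambda>xs. ?\<phi> xs - ?\<phi>' xs) = delta X op scaleN 1 (cochain1 X \<nu>)"
    using injD[OF inj_i] by (simp only: fun_eq_iff) blast
  then show ?thesis
    using cochain1_in_CTQ[of X \<nu>] by (simp add: BTQ_2)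
qed

lemma lift_of_obstruction_in_BTQ:
  assumes "quandle X op" and "short_exact_sequence scaleN scaleG scaleA i p"
    and "cochain1 X \<eta> \<in> ZTQ X op scaleA 1" and s: "pointed_section p s"
    and B: "obstruction X op scaleG i \<eta> s \<in> BTQ X op scaleN 2"
  shows "\<exists>\<eta>'. quandle_hom X op UNIV (alexander scaleG) \<eta>' \<and> (\<forall>x\<in>X. p (\<eta>' x) = \<eta> x)"
proof -
  interpret short_exact_sequence scaleN scaleG scaleA i p by fact
  from B obtain \<psi> where "\<psi> \<in> CTQ X 1" and \<psi>: "obstruction X op scaleG i \<eta> s = delta X op scaleN 1 \<psi>"
    by (auto simp: BTQ_2)
  define u where "u = (\<lambda>x. \<psi> [x])"
  have \<psi>u: "\<psi> = cochain1 X u"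
    unfolding u_def by (rule CTQ_1_eq_cochain1[OF \<open>\<psi> \<in> CTQ X 1\<close>])
  \<comment> \<open>This is \<open>h + i \<circ> \<psi>\<close>, written as the difference of two cochains with equal coboundary.\<close>
  let ?\<eta>' = "\<lambda>x. i (u x) - - s (\<eta> x)"
  have "delta X op scaleG 1 (cochain1 X (\<lambda>x. i (u x))) =
      delta X op scaleG 1 (cochain1 X (\<lambda>x. - s (\<eta> x)))"
    by (simp only: image_obstruction[OF assms(1-4), symmetric] \<psi> \<psi>u
        cochain1_hom[OF i.module_hom_axioms] delta_hom[OF i.module_hom_axioms])
  then have "delta X op scaleG 1 (cochain1 X ?\<eta>') = (\<lambda>_. 0)"
    by (simp only: cochain1_diff delta_diff[OF i.m2.module_axioms] fun_eq_iff) simp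
  then have "quandle_hom X op UNIV (alexander scaleG) ?\<eta>'"
    using ZTQ_1_of_delta_eq_0 ZTQ_1_iff_quandle_hom[OF i.m2.module_axioms assms(1)] by blast
  moreover have "p (i n) = 0" for n
    using exact by auto
  then have "p (?\<eta>' x) = \<eta> x" for x
    using s by (simp add: p.add pointed_section_def)
  ultimately show ?thesis by blast
qed


section \<open>The obstruction class\<close>

theorem theorem4p4:
  fixes X :: "'x set" and op :: "'x \<Rightarrow> 'x \<Rightarrow> 'x"
    and scaleN :: "laurent \<Rightarrow> 'n \<Rightarrow> 'n::ab_group_add"
    and scaleG :: "laurent \<Rightarrow> 'g \<Rightarrow> 'g::ab_group_add"
    and scaleA :: "laurent \<Rightarrow> 'a \<Rightarrow> 'a::ab_group_add"
    and i :: "'n \<Rightarrow> 'g" and p :: "'g \<Rightarrow> 'a" and \<eta> :: "'x \<Rightarrow> 'a"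
  assumes "quandle X op"
    and "short_exact_sequence scaleN scaleG scaleA i p"
    and "cochain1 X \<eta> \<in> ZTQ X op scaleA 1"
  shows "(\<forall>s. pointed_section p s \<longrightarrow>
            (\<exists>!\<phi>. is_obstruction X op scaleG i \<eta> s \<phi>) \<and>
            obstruction X op scaleG i \<eta> s \<in> ZTQ X op scaleN 2 \<and>
            HTQ_class X op scaleN 2 (obstruction X op scaleG i \<eta> s) \<in> HTQ X op scaleN 2) \<and>
         (\<forall>s s'. pointed_section p s \<longrightarrow> pointed_section p s' \<longrightarrow>
            HTQ_class X op scaleN 2 (obstruction X op scaleG i \<eta> s) =
            HTQ_class X op scaleN 2 (obstruction X op scaleG i \<eta> s')) \<and>
         (\<forall>s. pointed_section p s \<longrightarrow>
            HTQ_class X op scaleN 2 (obstruction X op scaleG i \<eta> s) = HTQ_zero X op scaleN 2 \<longrightarrow>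
            (\<exists>\<eta>'. quandle_hom X op UNIV (alexander scaleG) \<eta>' \<and> (\<forall>x\<in>X. p (\<eta>' x) = \<eta> x)))"
proof (intro conjI allI impI)
  interpret short_exact_sequence scaleN scaleG scaleA i p by fact
  let ?O = "obstruction X op scaleG i \<eta>"
  note eq = equiv_cohomologous[OF i.m1.module_axioms, of X op 2]
  show "\<exists>!\<phi>. is_obstruction X op scaleG i \<eta> s \<phi>" if "pointed_section p s" for s
    by (rule ex1_is_obstruction[OF assms that])
  show Z: "?O s \<in> ZTQ X op scaleN 2" if "pointed_section p s" for s
    by (rule obstruction_in_ZTQ[OF assms that])
  show "HTQ_class X op scaleN 2 (?O s) \<in> HTQ X op scaleN 2" if "pointed_section p s" for s
    unfolding HTQ_def HTQ_class_def by (rule quotientI[OF Z[OF that]])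
  show "HTQ_class X op scaleN 2 (?O s) = HTQ_class X op scaleN 2 (?O s')"
    if "pointed_section p s" "pointed_section p s'" for s s'
    unfolding HTQ_class_def
    by (rule equiv_class_eq[OF eq])
      (simp add: cohomologous_def Z that obstruction_diff_in_BTQ[OF assms that])
  show "\<exists>\<eta>'. quandle_hom X op UNIV (alexander scaleG) \<eta>' \<and> (\<forall>x\<in>X. p (\<eta>' x) = \<eta> x)"
    if s: "pointed_section p s" and "HTQ_class X op scaleN 2 (?O s) = HTQ_zero X op scaleN 2" for s
  proof -
    have "(\<lambda>_. 0, ?O s) \<in> cohomologous X op scaleN 2"
      using eq_equiv_class[OF _ eq Z[OF s]] that(2) by (simp add: HTQ_zero_def HTQ_class_def)
    then have "(?O s, \<lambda>_. 0) \<in> cohomologous X op scaleN 2"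
      using eq by (auto simp: equiv_def dest: symD)
    then have "?O s \<in> BTQ X op scaleN 2"
      by (simp add: cohomologous_def)
    then show ?thesis
      by (rule lift_of_obstruction_in_BTQ[OF assms s])
  qed
qed

end
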